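(* Consider a GraphCNN with decomposition $\mathbf{A}=\sum_{k=1}^K\mathbf{A}_k$ ($\mathbf{A},\mathbf{A}_k\in\mathbb{R}^{n\times n}$), weight matrices $\mathbf{W}_k^{(i)}\in\mathbb{R}^{d\times d}$ ($1\le k\le K$, $i\in\mathbb{N}^+$), and parametric ReLU activation $\sigma(t)=\max(t,at)$, $a\in(0,1)$, with random input $\mathbf{x}$, layer-$l$ output $\mathbf{y}^{(l)}$ (both vectorized), and diagonal mask matrices $\mathbf{P}^{(i)}$ as defined in the context. Let $$\gamma^{(i)}=\min_j\lambda_j\Big(\mathbf{P}^{(i)}\sum_{k=1}^K\big((\mathbf{W}_k^{(i)})^T\otimes\mathbf{A}_k\big)\Big).$$ If $\inf_i\gamma^{(i)}\ge1$ (for every value of the input), then $\mathcal{L}(\mathbf{y}^{(l)})=0$ for all $l\in\mathbb{N}^+$.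
   Context: $\lambda_j(\cdot)$ denotes the $j$-th singular value of a matrix and $\otimes$ the Kronecker product. The input $\mathbf{X}\in\mathbb{R}^{n\times d}$ is a random matrix; set $\mathbf{Y}^{(0)}=\mathbf{X}$. The GraphCNN is defined by $\mathbf{Y}^{(i+1)}=\sigma\big(\sum_{k=1}^K\mathbf{A}_k\mathbf{Y}^{(i)}\mathbf{W}_k^{(i+1)}\big)$, $i\ge0$, with $\sigma$ applied entrywise and deterministic matrices $\mathbf{A}_k,\mathbf{W}_k^{(i)}$. $\mathbf{A}$ is the adjacency matrix of an undirected graph on $n$ nodes. $\mathbf{x}$ and $\mathbf{y}^{(l)}$ are the column-stacking vectorizations of $\mathbf{X}$ and $\mathbf{Y}^{(l)}$ (with $\mathbf{y}^{(0)}=\mathbf{x}$). $\mathbf{P}^{(i+1)}$ is the $nd\times nd$ diagonal matrix with $(\mathbf{P}^{(i+1)})_{j,j}=1$ if $\big(\sum_{k}((\mathbf{W}_k^{(i+1)})^T\otimes\mathbf{A}_k)\mathbf{y}^{(i)}\big)_j\ge0$ and $(\mathbf{P}^{(i+1)})_{j,j}=a$ otherwise, so that $\mathbf{y}^{(i+1)}=\mathbf{P}^{(i+1)}\sum_k((\mathbf{W}_k^{(i+1)})^T\otimes\mathbf{A}_k)\mathbf{y}^{(i)}$; it depends on the input value. All random vectors have entries in finite alphabets (finite sets of reals); $\mathcal{H}$ is Shannon entropy, and the information loss is the conditional entropy $\mathcal{L}(\mathbf{y}^{(l)})=\mathcal{H}(\mathbf{x}\mid\mathbf{y}^{(l)})$.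 *)

theory Defs
  imports "HOL-Probability.Probability" "HOL-Computational_Algebra.Polynomial"
begin

text \<open>
  An n by d matrix has type \<open>real ^ 'd ^ 'n\<close>.  Vectors of length nd are indexed by the pair type
  \<open>'d \<times> 'n\<close>, with (column, row) playing the role of the position of an entry in the column-stacked
  vector: when both index types are enumerated, the lexicographic order of the pairs is the
  column-stacking order, and the formulas below are the usual vectorization and Kronecker product.
\<close>

definition vectorize :: "real ^ 'd ^ 'n \<Rightarrow> real ^ ('d \<times> 'n)" where
  "vectorize X = (\<chi> j. X $ snd j $ fst j)"

definition kronecker ::
  "real ^ 'b ^ 'a \<Rightarrow> real ^ 'd ^ 'c \<Rightarrow> real ^ ('b \<times> 'd) ^ ('a \<times> 'c)" (infixl \<open>\<otimes>\<^sub>K\<close> 75) where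
  "B \<otimes>\<^sub>K C = (\<chi> i j. B $ fst i $ fst j * C $ snd i $ snd j)"

definition charpoly :: "real ^ 'n ^ 'n \<Rightarrow> real poly" where
  "charpoly M = det (\<chi> i j. (if i = j then [:0, 1:] else 0) - [:M $ i $ j:])"

text \<open>
  The singular values of \<open>M\<close> are the square roots of the eigenvalues of \<open>transpose M ** M\<close>, counted
  with multiplicity and listed in decreasing order; the index runs from 1 to \<open>CARD('n)\<close>.
  All \<open>CARD('n)\<close> eigenvalues are real since the matrix is symmetric.
\<close>

definition singular_values :: "real ^ 'n ^ 'n \<Rightarrow> real list" where
  "singular_values M =
     rev (sorted_list_of_multiset (image_mset sqrt (proots (charpoly (transpose M ** M)))))"

definition singular_value :: "nat \<Rightarrow> real ^ 'n ^ 'n \<Rightarrow> real" where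
  "singular_value j M = singular_values M ! (j - 1)"

text \<open>Self-loops are permitted.\<close>

definition adjacency_matrix_of :: "('n \<Rightarrow> 'n \<Rightarrow> bool) \<Rightarrow> real ^ 'n ^ 'n" where
  "adjacency_matrix_of E = (\<chi> i j. if E i j then 1 else 0)"

definition undirected_adjacency_matrix :: "real ^ 'n ^ 'n \<Rightarrow> bool" where
  "undirected_adjacency_matrix A \<longleftrightarrow> (\<exists>E. symp E \<and> A = adjacency_matrix_of E)"

definition prelu :: "real \<Rightarrow> real \<Rightarrow> real" where
  "prelu a t = max t (a * t)"

text \<open>The weight matrix with layer superscript \<open>i\<close> and subscript \<open>k\<close> is \<open>W i k\<close>.\<close>

primrec graphcnn ::
  "(real \<Rightarrow> real) \<Rightarrow> nat \<Rightarrow> (nat \<Rightarrow> real ^ 'n ^ 'n) \<Rightarrow> (nat \<Rightarrow> nat \<Rightarrow> real ^ 'd ^ 'd) \<Rightarrow>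
     real ^ 'd ^ 'n \<Rightarrow> nat \<Rightarrow> real ^ 'd ^ 'n" where
  "graphcnn \<sigma> K A W X 0 = X"
| "graphcnn \<sigma> K A W X (Suc i) =
     map_matrix \<sigma> (\<Sum>k = 1..K. A k ** graphcnn \<sigma> K A W X i ** W (Suc i) k)"

definition layer_matrix ::
  "nat \<Rightarrow> (nat \<Rightarrow> real ^ 'n ^ 'n) \<Rightarrow> (nat \<Rightarrow> nat \<Rightarrow> real ^ 'd ^ 'd) \<Rightarrow> nat \<Rightarrow>
     real ^ ('d \<times> 'n) ^ ('d \<times> 'n)" where
  "layer_matrix K A W i = (\<Sum>k = 1..K. transpose (W i k) \<otimes>\<^sub>K A k)"

text \<open>The mask of layer \<open>i \<ge> 1\<close>, for the parametric ReLU network with input value \<open>X\<close>.\<close>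

definition mask ::
  "real \<Rightarrow> nat \<Rightarrow> (nat \<Rightarrow> real ^ 'n ^ 'n) \<Rightarrow> (nat \<Rightarrow> nat \<Rightarrow> real ^ 'd ^ 'd) \<Rightarrow>
     real ^ 'd ^ 'n \<Rightarrow> nat \<Rightarrow> real ^ ('d \<times> 'n) ^ ('d \<times> 'n)" where
  "mask a K A W X i = (\<chi> j l.
     if j = l then
       (if (layer_matrix K A W i *v vectorize (graphcnn (prelu a) K A W X (i - 1))) $ j \<ge> 0
        then 1 else a)
     else 0)"

definition layer_gamma ::
  "real \<Rightarrow> nat \<Rightarrow> (nat \<Rightarrow> real ^ 'n ^ 'n) \<Rightarrow> (nat \<Rightarrow> nat \<Rightarrow> real ^ 'd ^ 'd) \<Rightarrow>
     real ^ 'd ^ 'n \<Rightarrow> nat \<Rightarrow> real" where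
  "layer_gamma a K A W X i =
     (MIN j\<in>{1..CARD('d \<times> 'n)}. singular_value j (mask a K A W X i ** layer_matrix K A W i))"

lemma vectorize_layer:
  fixes Y :: "real ^ 'd ^ 'n"
  shows "layer_matrix K A W i *v vectorize Y = vectorize (\<Sum>k = 1..K. A k ** Y ** W i k)"
proof -
  have *: "(transpose V \<otimes>\<^sub>K B) *v vectorize Y = vectorize (B ** Y ** V)"
    for V :: "real ^ 'd ^ 'd" and B :: "real ^ 'n ^ 'n"
  proof (intro vec_eq_iff[THEN iffD2] allI)
    fix j :: "'d \<times> 'n"
    have "((transpose V \<otimes>\<^sub>K B) *v vectorize Y) $ j
        = (\<Sum>q\<in>UNIV. \<Sum>s\<in>UNIV. V $ q $ fst j * B $ snd j $ s * Y $ s $ q)"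
      by (simp add: matrix_vector_mult_def kronecker_def vectorize_def transpose_def
          sum.cartesian_product case_prod_unfold)
    also have "\<dots> = vectorize (B ** Y ** V) $ j"
      by (simp add: matrix_matrix_mult_def vectorize_def sum_distrib_left sum_distrib_right mult_ac)
    finally show "((transpose V \<otimes>\<^sub>K B) *v vectorize Y) $ j = vectorize (B ** Y ** V) $ j" .
  qed
  have lin: "vectorize (\<Sum>k\<in>S. f k) = (\<Sum>k\<in>S. vectorize (f k))"
    for S :: "nat set" and f :: "nat \<Rightarrow> real ^ 'd ^ 'n"
    by (simp add: vectorize_def vec_eq_iff)
  have "layer_matrix K A W i *v v = (\<Sum>k = 1..K. (transpose (W i k) \<otimes>\<^sub>K A k) *v v)" for v
    unfolding layer_matrix_def
    by (induction K) (simp_all add: matrix_vector_mult_add_rdistrib)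
  then show ?thesis by (simp add: * lin)
qed

lemma vectorize_graphcnn_Suc:
  assumes "0 < a" "a < 1"
  shows "vectorize (graphcnn (prelu a) K A W X (Suc i)) =
    mask a K A W X (Suc i) *v
      (layer_matrix K A W (Suc i) *v vectorize (graphcnn (prelu a) K A W X i))"
proof -
  have relu: "prelu a t = (if t \<ge> 0 then 1 else a) * t" for t :: real
  proof (cases "t \<ge> 0")
    case True
    then have "a * t \<le> t" using assms by (simp add: mult_left_le_one_le)
    then show ?thesis using True by (simp add: prelu_def)
  next
    case False
    then have "t \<le> a * t" using assms by (simp add: mult_le_cancel_right1)
    then show ?thesis using False by (simp add: prelu_def)
  qed
  let ?z = "layer_matrix K A W (Suc i) *v vectorize (graphcnn (prelu a) K A W X i)"
  have "(mask a K A W X (Suc i) *v ?z) $ j = prelu a (?z $ j)" for j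
  proof -
    have "(mask a K A W X (Suc i) *v ?z) $ j =
      (\<Sum>l\<in>UNIV. if j = l then (if ?z $ j \<ge> 0 then 1 else a) * ?z $ l else 0)"
      by (subst matrix_vector_mult_def) (simp add: mask_def if_distrib[of "\<lambda>x. x * _"] cong: if_cong)
    also have "\<dots> = (if ?z $ j \<ge> 0 then 1 else a) * ?z $ j" by simp
    finally show ?thesis by (simp only: relu)
  qed
  then show ?thesis
    unfolding vectorize_layer by (simp add: vec_eq_iff vectorize_def)
qed

definition (in information_space) information_loss :: "('a \<Rightarrow> 'x) \<Rightarrow> ('a \<Rightarrow> 'y) \<Rightarrow> real" where
  "information_loss x y = \<H>(x | y)"

end

theory Submission
  imports Defs
begin

text \<open>
  A zero eigenvalue of \<open>transpose M ** M\<close> puts the value 0 among the singular values of \<open>M\<close>.  Hence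
  the hypothesis makes every masked layer matrix invertible, and so every layer matrix, which does
  not depend on the input.  As the parametric ReLU is injective, the whole network is an injective
  function of its input, and an injective function of a finitely valued random variable determines it.
\<close>

section \<open>Singular values\<close>

lemma poly_det:
  fixes P :: "'a::comm_ring_1 poly ^ 'n ^ 'n"
  shows "poly (det P) x = det (\<chi> i j. poly (P $ i $ j) x)"
  by (simp add: det_def poly_sum poly_prod sign_def)

lemma poly_charpoly: "poly (charpoly M) x = det (mat x - M)"
  unfolding charpoly_def poly_det
  by (rule arg_cong[where f = det]) (simp add: vec_eq_iff mat_def)

text \<open>Each Leibniz term of the determinant is a product of \<open>CARD('n)\<close> entries of
  degree at most 1. The bound limits the number of roots, hence of listed singular values.\<close>

lemma degree_charpoly_le:
  fixes M :: "real ^ 'n ^ 'n"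
  shows "degree (charpoly M) \<le> CARD('n)"
proof -
  let ?E = "\<lambda>i j. (if i = j then [:0, 1:] else 0) - [:M $ i $ j:]"
  have "degree (of_int (sign p) * (\<Prod>i\<in>UNIV. ?E i (p i))) \<le> CARD('n)" for p :: "'n \<Rightarrow> 'n"
  proof -
    have "degree (\<Prod>i\<in>UNIV. ?E i (p i)) \<le> (\<Sum>i\<in>UNIV. degree (?E i (p i)))"
      using degree_prod_sum_le[of UNIV "\<lambda>i. ?E i (p i)"] by (simp add: o_def)
    also have "\<dots> \<le> (\<Sum>i\<in>(UNIV :: 'n set). 1)"
      by (rule sum_mono) simp
    finally show ?thesis by (simp add: sign_def)
  qed
  then show ?thesis
    unfolding charpoly_def det_def by (intro degree_sum_le) auto
qed

lemma mat_mult_vector: "mat c *v v = c *\<^sub>R (v :: real ^ 'n)"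
  by (simp add: vec_eq_iff matrix_vector_mult_def mat_def if_distrib[of "\<lambda>x. x * _"] cong: if_cong)

text \<open>Adjointness of \<open>M\<close> and its transpose, with \<open>transpose M *v w\<close>
  written as \<open>w v* M\<close>.\<close>

lemma inner_vector_matrix_mult: "v \<bullet> (w v* M) = (M *v v) \<bullet> (w :: real ^ 'n)"
  by (metis dot_lmul_matrix inner_commute)

text \<open>The value -1 is not a root: pairing a kernel vector v with its equation gives |v|^2 +
  |Mv|^2 = 0. Being nonzero ensures that \<open>proots\<close> contains exactly the zeros.\<close>

lemma charpoly_gram_nonzero: "charpoly (transpose M ** M) \<noteq> 0"
proof -
  have "v = 0" if v: "(mat (-1) - transpose M ** M) *v v = 0" for v
  proof -
    have "- v - transpose M *v (M *v v) = 0"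
      using v by (simp add: matrix_vector_mult_diff_rdistrib mat_mult_vector
          matrix_vector_mul_assoc)
    then have "v \<bullet> (- v - transpose M *v (M *v v)) = 0" by simp
    then have "v \<bullet> v + (M *v v) \<bullet> (M *v v) = 0"
      by (simp add: inner_diff_right inner_vector_matrix_mult)
    then show "v = 0"
      by (simp add: add_nonneg_eq_0_iff)
  qed
  then have "invertible (mat (-1) - transpose M ** M)"
    by (simp add: invertible_left_inverse matrix_left_invertible_ker)
  then have "poly (charpoly (transpose M ** M)) (-1) \<noteq> 0"
    unfolding poly_charpoly by (simp add: invertible_det_nz)
  then show ?thesis by auto
qed

lemma length_singular_values_le:
  fixes M :: "real ^ 'n ^ 'n"
  shows "length (singular_values M) \<le> CARD('n)"
proof -
  have "length (singular_values M) = size (proots (charpoly (transpose M ** M)))"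
    unfolding singular_values_def
    by (metis length_rev mset_sorted_list_of_multiset size_image_mset size_mset)
  also have "\<dots> \<le> CARD('n)"
    using size_proots_le degree_charpoly_le order_trans by blast
  finally show ?thesis .
qed

lemma set_singular_values:
  "set (singular_values M) = sqrt ` {x. det (mat x - transpose M ** M) = 0}"
  by (simp add: singular_values_def charpoly_gram_nonzero poly_charpoly)

text \<open>Pairing the eigenvector equation with v gives x |v|^2 = |Mv|^2.\<close>

lemma gram_eigenvalue_nonneg:
  fixes M :: "real ^ 'n ^ 'm"
  assumes "det (mat x - transpose M ** M) = 0"
  shows "x \<ge> 0"
proof -
  have "\<not> invertible (mat x - transpose M ** M)"
    using assms by (simp add: invertible_det_nz)
  then obtain v where v: "(mat x - transpose M ** M) *v v = 0" "v \<noteq> 0"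
    by (auto simp: invertible_left_inverse matrix_left_invertible_ker)
  then have "x *\<^sub>R v = transpose M *v (M *v v)"
    by (simp add: matrix_vector_mult_diff_rdistrib mat_mult_vector matrix_vector_mul_assoc)
  then have "v \<bullet> (x *\<^sub>R v) = v \<bullet> (transpose M *v (M *v v))" by simp
  then have "x * (v \<bullet> v) = (M *v v) \<bullet> (M *v v)"
    by (simp add: inner_vector_matrix_mult)
  then have "x * (v \<bullet> v) \<ge> 0" by simp
  then show ?thesis
    using v(2) by (simp add: zero_le_mult_iff flip: inner_gt_zero_iff)
qed

text \<open>The recursion of \<open>!\<close> past the end of a list stops at an unspecified value
  that depends only on the overshoot, not on the entries.\<close>

lemma nth_beyond_length: "length xs \<le> n \<Longrightarrow> xs ! n = [] ! (n - length xs)"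
  by (induction xs arbitrary: n) (auto simp: nth_Cons split: nat.split)

text \<open>
  The finitely many values \<open>[] ! m\<close> are included in the bound because they are what
  \<open>singular_value j\<close> returns beyond the end of the list.  This avoids the spectral theorem, by
  which the list has full length.
\<close>

lemma singular_value_bdd_below:
  "\<exists>c. \<forall>j\<in>{1..CARD('n)}. \<forall>M :: real ^ 'n ^ 'n. c \<le> singular_value j M"
proof -
  define S where "S = insert 0 ((\<lambda>m. ([] :: real list) ! m) ` {..CARD('n)})"
  have "Min S \<le> singular_value j M" if j: "j \<in> {1..CARD('n)}" for j and M :: "real ^ 'n ^ 'n"
  proof (cases "j - 1 < length (singular_values M)")
    case True
    then have "singular_value j M \<in> set (singular_values M)"
      by (simp add: singular_value_def)
    then have "0 \<le> singular_value j M"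
      by (auto simp: set_singular_values dest: gram_eigenvalue_nonneg)
    moreover have "Min S \<le> 0" by (simp add: S_def)
    ultimately show ?thesis by linarith
  next
    case False
    then have "singular_value j M = [] ! (j - 1 - length (singular_values M))"
      unfolding singular_value_def by (intro nth_beyond_length) simp
    then have "singular_value j M \<in> S"
      using j by (auto simp: S_def)
    then show ?thesis by (intro Min_le) (simp_all add: S_def)
  qed
  then show ?thesis by blast
qed

text \<open>A kernel vector of \<open>M\<close> is an eigenvector of \<open>transpose M ** M\<close>
  for the eigenvalue 0, and \<open>sqrt 0 = 0\<close> then occurs in the list.\<close>

lemma invertible_if_singular_values_pos:
  fixes M :: "real ^ 'n ^ 'n"
  assumes "\<And>j. j \<in> {1..CARD('n)} \<Longrightarrow> singular_value j M > 0"
  shows "invertible M"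
proof (rule ccontr)
  assume "\<not> invertible M"
  then obtain v where v: "M *v v = 0" "v \<noteq> 0"
    by (auto simp: invertible_left_inverse matrix_left_invertible_ker)
  have "(mat 0 - transpose M ** M) *v v = mat 0 *v v - transpose M *v (M *v v)"
    by (simp only: matrix_vector_mult_diff_rdistrib matrix_vector_mul_assoc)
  also have "\<dots> = 0" using v(1) by simp
  finally have "\<not> invertible (mat 0 - transpose M ** M)"
    using v(2) by (auto simp: invertible_left_inverse matrix_left_invertible_ker)
  then have "det (mat 0 - transpose M ** M) = 0"
    by (simp add: invertible_det_nz)
  then have "0 \<in> set (singular_values M)"
    by (force simp: set_singular_values)
  then obtain k where k: "k < length (singular_values M)" "singular_values M ! k = 0"
    by (auto simp: in_set_conv_nth)
  \<comment> \<open>List positions start at 0 and singular value indices at 1; the length bound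
    keeps \<open>Suc k\<close> in range.\<close>
  then have "singular_value (Suc k) M = 0" by (simp add: singular_value_def)
  moreover have "Suc k \<in> {1..CARD('n)}"
    using k(1) length_singular_values_le[of M] by simp
  ultimately show False using assms by fastforce
qed

section \<open>Injectivity of the network\<close>

text \<open>A real infimum is known to lie below the members only when the set is bounded below. The
  bound on singular values is uniform in the matrix, so one constant serves all layers.\<close>

lemma layer_gamma_bdd_below:
  fixes W :: "nat \<Rightarrow> nat \<Rightarrow> real ^ 'd ^ 'd" and X :: "real ^ 'd ^ 'n"
  shows "bdd_below (range (layer_gamma a K As W X))"
proof -
  obtain c where "\<forall>j\<in>{1..CARD('d \<times> 'n)}. \<forall>M :: real ^ ('d \<times> 'n) ^ ('d \<times> 'n).
      c \<le> singular_value j M"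
    using singular_value_bdd_below by blast
  then have "c \<le> layer_gamma a K As W X i" for i
    unfolding layer_gamma_def by (subst Min_ge_iff) (auto simp: Suc_le_eq)
  then show ?thesis by (intro bdd_belowI[of _ c]) blast
qed

lemma layer_matrix_inj:
  fixes X :: "real ^ 'd ^ 'n"
  assumes "(INF i\<in>{1..}. layer_gamma a K As W X i) \<ge> 1" and "i \<ge> 1"
  shows "inj ((*v) (layer_matrix K As W i))"
proof -
  let ?L = "layer_matrix K As W i" and ?P = "mask a K As W X i"
  have "bdd_below (layer_gamma a K As W X ` {1..})"
    using layer_gamma_bdd_below by (rule bdd_below_mono) auto
  then have "(INF i\<in>{1..}. layer_gamma a K As W X i) \<le> layer_gamma a K As W X i"
    using assms(2) by (intro cINF_lower) auto
  with assms(1) have ge: "1 \<le> layer_gamma a K As W X i" by linarith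
  have "singular_value j (?P ** ?L) > 0" if "j \<in> {1..CARD('d \<times> 'n)}" for j
  proof -
    have "layer_gamma a K As W X i \<le> singular_value j (?P ** ?L)"
      unfolding layer_gamma_def by (rule Min_le) (use that in auto)
    with ge show ?thesis by linarith
  qed
  then have "invertible (?P ** ?L)"
    by (rule invertible_if_singular_values_pos)
  \<comment> \<open>A nonzero determinant of the product forces a nonzero determinant of each
    factor, which removes the input-dependent mask.\<close>
  then have "invertible ?L"
    by (simp add: invertible_det_nz det_mul)
  then show ?thesis
    by (simp add: invertible_left_inverse matrix_left_invertible_injective)
qed

text \<open>Both branches t and at are strictly increasing as a > 0, and so is their
  maximum.\<close>

lemma prelu_inj:
  assumes "0 < a" "a < 1"
  shows "inj (prelu a)"
proof -
  have "prelu a s < prelu a t" if "s < t" for s t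
  proof -
    have "s < max t (a * t)" using that by simp
    moreover have "a * s < max t (a * t)" using that assms by (simp add: less_max_iff_disj)
    ultimately show ?thesis by (simp add: prelu_def)
  qed
  then have "strict_mono (prelu a)" by (rule strict_monoI)
  then show ?thesis by (rule strict_mono_imp_inj_on)
qed

lemma vectorize_inj: "inj vectorize"
  by (rule injI) (simp add: vectorize_def vec_eq_iff)

lemma graphcnn_inj:
  fixes As :: "nat \<Rightarrow> real ^ 'n ^ 'n" and W :: "nat \<Rightarrow> nat \<Rightarrow> real ^ 'd ^ 'd"
  assumes "inj \<sigma>" and "\<And>i. i \<ge> 1 \<Longrightarrow> inj ((*v) (layer_matrix K As W i))"
  shows "inj (\<lambda>X. graphcnn \<sigma> K As W X l)"
proof (induction l)
  case 0
  show ?case by (simp add: inj_def)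
next
  case (Suc l)
  let ?S = "\<lambda>Y. \<Sum>k = 1..K. As k ** Y ** W (Suc l) k"
  \<comment> \<open>In vectorized form the linear part of the layer is multiplication by the layer
    matrix; the outer \<open>vectorize\<close> is stripped off afterwards.\<close>
  have "inj (\<lambda>Y. vectorize (?S Y))"
    using inj_compose[OF assms(2)[of "Suc l"] vectorize_inj]
    by (simp add: o_def vectorize_layer del: sum.cl_ivl_Suc)
  then have "inj ?S"
    by (intro inj_on_imageI2[of vectorize]) (simp add: o_def)
  moreover have "inj (map_matrix \<sigma> :: real ^ 'd ^ 'n \<Rightarrow> _)"
    by (rule injI) (simp add: map_matrix_def vec_eq_iff inj_eq[OF assms(1)])
  ultimately have "inj (map_matrix \<sigma> \<circ> ?S \<circ> (\<lambda>X. graphcnn \<sigma> K As W X l))"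
    using Suc by (intro inj_compose)
  then show ?case by (simp add: o_def)
qed

section \<open>Information loss\<close>

text \<open>By the chain rule H(X) = H(f(X)) + H(X | f(X)), and an injective relabelling of the
  values preserves entropy.\<close>

lemma (in information_space) conditional_entropy_of_inj:
  assumes X: "simple_function M X" and "inj_on f (X ` space M)"
  shows "\<H>(X | f \<circ> X) = 0"
  using entropy_partition[OF X, of f] entropy_of_inj[OF assms] by simp

lemma finite_matrices_over:
  fixes S :: "'a set"
  assumes "finite S"
  shows "finite {Z :: 'a ^ 'd::finite ^ 'n::finite. \<forall>p q. Z $ p $ q \<in> S}"
proof (rule finite_imageD)
  let ?f = "\<lambda>Z :: 'a ^ 'd ^ 'n. \<lambda>(p, q). Z $ p $ q"
  have "?f ` {Z. \<forall>p q. Z $ p $ q \<in> S} \<subseteq> UNIV \<rightarrow>\<^sub>E S"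
    by auto
  then show "finite (?f ` {Z. \<forall>p q. Z $ p $ q \<in> S})"
    by (rule finite_subset) (simp add: finite_PiE assms)
  show "inj_on ?f {Z. \<forall>p q. Z $ p $ q \<in> S}"
    by (auto intro!: inj_onI simp: vec_eq_iff fun_eq_iff)
qed

theorem theorem4:
  fixes M :: "'w measure" and b :: real
    and X :: "'w \<Rightarrow> real ^ 'd ^ 'n" and alphabet :: "real set"
    and A :: "real ^ 'n ^ 'n" and As :: "nat \<Rightarrow> real ^ 'n ^ 'n"
    and W :: "nat \<Rightarrow> nat \<Rightarrow> real ^ 'd ^ 'd" and K :: nat and a :: real
  assumes "information_space M b"
    and "X \<in> borel_measurable M"
    and "finite alphabet"
    and "\<forall>\<omega>\<in>space M. \<forall>p q. X \<omega> $ p $ q \<in> alphabet"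
    and "undirected_adjacency_matrix A"
    and "A = (\<Sum>k = 1..K. As k)"
    and "0 < a" and "a < 1"
    and "\<forall>\<omega>\<in>space M. (INF i\<in>{1..}. layer_gamma a K As W (X \<omega>) i) \<ge> 1"
  shows "\<forall>l\<ge>1. information_space.information_loss M b
    (\<lambda>\<omega>. vectorize (X \<omega>))
    (\<lambda>\<omega>. vectorize (graphcnn (prelu a) K As W (X \<omega>) l)) = 0"
proof (intro allI impI)
  fix l :: nat
  interpret information_space M b by fact
  \<comment> \<open>A probability space is nonempty. The layer matrices are shared by all inputs, so
    their injectivity can be read off at one sample point.\<close>
  obtain \<omega>0 where "\<omega>0 \<in> space M" using not_empty by blast
  with assms(9) have "(INF i\<in>{1..}. layer_gamma a K As W (X \<omega>0) i) \<ge> 1" by blast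
  then have "inj ((*v) (layer_matrix K As W i))" if "i \<ge> 1" for i
    using that by (rule layer_matrix_inj)
  then have net: "inj (\<lambda>Z. graphcnn (prelu a) K As W Z l)"
    by (intro graphcnn_inj prelu_inj assms(7,8))
  have "finite (X ` space M)"
    by (rule finite_subset[OF _ finite_matrices_over[OF assms(3)]]) (use assms(4) in auto)
  then have "simple_function M X"
    using assms(2) by (simp add: simple_function_borel_measurable)
  then have x: "simple_function M (vectorize \<circ> X)"
    by (rule simple_function_compose)
  \<comment> \<open>The output has to be a function of the vectorized input, so \<open>f\<close>
    first recovers the matrix by \<open>inv vectorize\<close> and then runs the network.\<close>
  define f where "f v = vectorize (graphcnn (prelu a) K As W (inv vectorize v) l)"
    for v :: "real ^ ('d \<times> 'n)"
  have f: "f (vectorize Z) = vectorize (graphcnn (prelu a) K As W Z l)" for Z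
    by (simp add: f_def vectorize_inj)
  have "inj (f \<circ> vectorize)"
    using inj_compose[OF vectorize_inj net] by (simp add: o_def f)
  then have "inj_on f (range vectorize)"
    by (rule inj_on_imageI)
  then have "inj_on f ((vectorize \<circ> X) ` space M)"
    by (rule inj_on_subset) auto
  from conditional_entropy_of_inj[OF x this]
  show "information_loss (\<lambda>\<omega>. vectorize (X \<omega>))
    (\<lambda>\<omega>. vectorize (graphcnn (prelu a) K As W (X \<omega>) l)) = 0"
    by (simp add: information_loss_def o_def f)
qed

end
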